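(* Let $(X,d)$ be a nonempty pseudometric space with metric reflection $(X/{\sim_d},\delta_d)$. Then the following statements are equivalent: (i) At least one of the following conditions is fulfilled: (i$_1$) $(X,d)$ is strongly rigid; (i$_2$) $(X,d)$ is discrete; (i$_3$) $(X,d)$ is a pseudorectangle. (ii) The equality $\mathbf{Cs}(X/{\sim_d},\delta_d)=\mathbf{Sym}(X/{\sim_d})$ holds.
   Context: A pseudometric on a set $X$ is a function $d\colon X^2\to\mathbb{R}$ that is non-negative, symmetric, satisfies $d(x,x)=0$ for all $x$, and satisfies the triangle inequality. Write $d(X^2)=\{d(x,y):x,y\in X\}$. The relation $x\sim_d y :\Leftrightarrow d(x,y)=0$ is an equivalence relation on $X$; the metric reflection of $(X,d)$ is the metric space $(X/{\sim_d},\delta_d)$ with $\delta_d(\alpha,\beta)=d(x,y)$ for $x\in\alpha$, $y\in\beta$ (well defined). A combinatorial self-similarity of a (pseudo)metric space $(X,d)$ is a bijection $\Psi\colon X\to X$ for which there is a bijection $f\colon d(X^2)\to d(X^2)$ with $d(x,y)=f(d(\Psi(x),\Psi(y)))$ for all $x,y\in X$; $\mathbf{Cs}(X,d)$ is the group of all of them. $\mathbf{Sym}(X)$ is the group of all permutations of $X$. A metric subspace of a pseudometric space $(X,d)$ is a subset $Y\subseteq X$ such that $d|_{Y^2}$ is a metric. A metric space is strongly rigid if $d(x,y)=d(u,v)\neq 0$ implies $\{x,y\}=\{u,v\}$; a metric space is discrete if $|d(X^2)|\le 2$. A pseudometric space is strongly rigid (resp. discrete) if all its metric subspaces are strongly rigid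 (resp. discrete). A pseudometric space $(X,d)$ is a pseudorectangle if all three-point metric subspaces of $(X,d)$ are strongly rigid and pairwise isometric and, in addition, there is a four-point metric subspace $Y$ of $(X,d)$ such that for every $x\in X$ there is $y\in Y$ with $d(x,y)=0$. *)

theory Defs
  imports Complex_Main "HOL-Algebra.Bij"
begin

text \<open>All axioms are relativised to the carrier; the library locale \<open>Metric_space\<close>
  instead demands non-negativity and symmetry on the whole type, which is why it is not used.\<close>

locale pseudometric_space =
  fixes X :: "'a set" and d :: "'a \<Rightarrow> 'a \<Rightarrow> real"
  assumes nonneg: "\<lbrakk>x \<in> X; y \<in> X\<rbrakk> \<Longrightarrow> 0 \<le> d x y"
    and commute: "\<lbrakk>x \<in> X; y \<in> X\<rbrakk> \<Longrightarrow> d x y = d y x"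
    and zero_refl: "x \<in> X \<Longrightarrow> d x x = 0"
    and triangle: "\<lbrakk>x \<in> X; y \<in> X; z \<in> X\<rbrakk> \<Longrightarrow> d x z \<le> d x y + d y z"

locale metric_space_on = pseudometric_space +
  assumes zero_imp_eq: "\<lbrakk>x \<in> X; y \<in> X; d x y = 0\<rbrakk> \<Longrightarrow> x = y"

definition dist_values :: "'a set \<Rightarrow> ('a \<Rightarrow> 'a \<Rightarrow> real) \<Rightarrow> real set"
  where "dist_values X d = {d x y |x y. x \<in> X \<and> y \<in> X}"

definition zero_rel :: "'a set \<Rightarrow> ('a \<Rightarrow> 'a \<Rightarrow> real) \<Rightarrow> 'a rel"
  where "zero_rel X d = {(x, y). x \<in> X \<and> y \<in> X \<and> d x y = 0}"

definition reflection :: "'a set \<Rightarrow> ('a \<Rightarrow> 'a \<Rightarrow> real) \<Rightarrow> 'a set set"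
  where "reflection X d = X // zero_rel X d"

definition reflection_dist :: "('a \<Rightarrow> 'a \<Rightarrow> real) \<Rightarrow> 'a set \<Rightarrow> 'a set \<Rightarrow> real"
  where "reflection_dist d \<alpha> \<beta> = (THE r. \<exists>x\<in>\<alpha>. \<exists>y\<in>\<beta>. r = d x y)"

definition comb_self_similarity :: "'a set \<Rightarrow> ('a \<Rightarrow> 'a \<Rightarrow> real) \<Rightarrow> ('a \<Rightarrow> 'a) \<Rightarrow> bool"
  where "comb_self_similarity X d \<Psi> \<longleftrightarrow>
    bij_betw \<Psi> X X \<and>
    (\<exists>f. bij_betw f (dist_values X d) (dist_values X d) \<and>
         (\<forall>x\<in>X. \<forall>y\<in>X. d x y = f (d (\<Psi> x) (\<Psi> y))))"

text \<open>The symmetric group on a set \<open>X\<close> is the library's \<open>BijGroup X\<close>, whose elements are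
  the bijections of \<open>X\<close> that are extensional (\<open>undefined\<close> outside \<open>X\<close>), so that
  equality of elements is equality on \<open>X\<close>.\<close>

definition Cs :: "'a set \<Rightarrow> ('a \<Rightarrow> 'a \<Rightarrow> real) \<Rightarrow> ('a \<Rightarrow> 'a) monoid"
  where "Cs X d = (BijGroup X)\<lparr>carrier := {\<Psi> \<in> Bij X. comb_self_similarity X d \<Psi>}\<rparr>"

definition metric_subspace :: "'a set \<Rightarrow> 'a set \<Rightarrow> ('a \<Rightarrow> 'a \<Rightarrow> real) \<Rightarrow> bool"
  where "metric_subspace Y X d \<longleftrightarrow> Y \<subseteq> X \<and> metric_space_on Y d"

definition strongly_rigid_metric :: "'a set \<Rightarrow> ('a \<Rightarrow> 'a \<Rightarrow> real) \<Rightarrow> bool"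
  where "strongly_rigid_metric Y d \<longleftrightarrow>
    (\<forall>x\<in>Y. \<forall>y\<in>Y. \<forall>u\<in>Y. \<forall>v\<in>Y. d x y = d u v \<and> d u v \<noteq> 0 \<longrightarrow> {x, y} = {u, v})"

definition discrete_metric :: "'a set \<Rightarrow> ('a \<Rightarrow> 'a \<Rightarrow> real) \<Rightarrow> bool"
  where "discrete_metric Y d \<longleftrightarrow> finite (dist_values Y d) \<and> card (dist_values Y d) \<le> 2"

definition isometric :: "'a set \<Rightarrow> 'a set \<Rightarrow> ('a \<Rightarrow> 'a \<Rightarrow> real) \<Rightarrow> bool"
  where "isometric Y Z d \<longleftrightarrow>
    (\<exists>g. bij_betw g Y Z \<and> (\<forall>x\<in>Y. \<forall>y\<in>Y. d (g x) (g y) = d x y))"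

definition strongly_rigid :: "'a set \<Rightarrow> ('a \<Rightarrow> 'a \<Rightarrow> real) \<Rightarrow> bool"
  where "strongly_rigid X d \<longleftrightarrow> (\<forall>Y. metric_subspace Y X d \<longrightarrow> strongly_rigid_metric Y d)"

definition discrete_pseudometric :: "'a set \<Rightarrow> ('a \<Rightarrow> 'a \<Rightarrow> real) \<Rightarrow> bool"
  where "discrete_pseudometric X d \<longleftrightarrow> (\<forall>Y. metric_subspace Y X d \<longrightarrow> discrete_metric Y d)"

definition pseudorectangle :: "'a set \<Rightarrow> ('a \<Rightarrow> 'a \<Rightarrow> real) \<Rightarrow> bool"
  where "pseudorectangle X d \<longleftrightarrow>
    (\<forall>Y. metric_subspace Y X d \<and> card Y = 3 \<longrightarrow> strongly_rigid_metric Y d) \<and>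
    (\<forall>Y Z. metric_subspace Y X d \<and> card Y = 3 \<and> metric_subspace Z X d \<and> card Z = 3
        \<longrightarrow> isometric Y Z d) \<and>
    (\<exists>Y. metric_subspace Y X d \<and> card Y = 4 \<and> (\<forall>x\<in>X. \<exists>y\<in>Y. d x y = 0))"

context pseudometric_space
begin

lemma equiv_zero_rel: "equiv X (zero_rel X d)"
proof (rule equivI)
  show "zero_rel X d \<subseteq> X \<times> X" by (auto simp: zero_rel_def)
  show "refl_on X (zero_rel X d)" by (auto simp: refl_on_def zero_rel_def zero_refl)
  show "sym (zero_rel X d)" by (auto simp: sym_def zero_rel_def commute)
  show "trans (zero_rel X d)"
  proof (rule transI)
    fix x y z assume "(x, y) \<in> zero_rel X d" "(y, z) \<in> zero_rel X d"
    then show "(x, z) \<in> zero_rel X d"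
      using triangle[of x y z] nonneg[of x z] by (auto simp: zero_rel_def)
  qed
qed

lemma dist_cong:
  assumes "(x, x') \<in> zero_rel X d" "(y, y') \<in> zero_rel X d"
  shows "d x y = d x' y'"
proof -
  have X: "x \<in> X" "x' \<in> X" "y \<in> X" "y' \<in> X" and z: "d x x' = 0" "d y y' = 0"
    using assms by (auto simp: zero_rel_def)
  have z': "d x' x = 0" "d y' y = 0" using z X commute by auto
  show ?thesis
    using triangle[of x x' y] triangle[of x' y' y] triangle[of x' x y'] triangle[of x y y'] X z z'
    by linarith
qed

lemma reflection_dist_eq:
  assumes "\<alpha> \<in> reflection X d" "\<beta> \<in> reflection X d" "x \<in> \<alpha>" "y \<in> \<beta>"
  shows "reflection_dist d \<alpha> \<beta> = d x y"
  unfolding reflection_dist_def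
proof (rule the_equality)
  show "\<exists>u\<in>\<alpha>. \<exists>v\<in>\<beta>. d x y = d u v" using assms by blast
  fix r assume "\<exists>u\<in>\<alpha>. \<exists>v\<in>\<beta>. r = d u v"
  then obtain u v where uv: "u \<in> \<alpha>" "v \<in> \<beta>" "r = d u v" by blast
  have "(u, x) \<in> zero_rel X d" "(v, y) \<in> zero_rel X d"
    using assms uv quotient_eq_iff[OF equiv_zero_rel] unfolding reflection_def by blast+
  then show "r = d x y" using dist_cong uv by simp
qed

lemma metric_space_reflection: "metric_space_on (reflection X d) (reflection_dist d)"
proof -
  have rep: "\<exists>x. x \<in> \<alpha> \<and> x \<in> X" if "\<alpha> \<in> reflection X d" for \<alpha>
    using that in_quotient_imp_non_empty[OF equiv_zero_rel] in_quotient_imp_subset[OF equiv_zero_rel]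
    unfolding reflection_def by blast
  show ?thesis
  proof
    fix \<alpha> \<beta> assume a: "\<alpha> \<in> reflection X d" and b: "\<beta> \<in> reflection X d"
    obtain x y where x: "x \<in> \<alpha>" "x \<in> X" and y: "y \<in> \<beta>" "y \<in> X" using rep a b by meson
    have e: "reflection_dist d \<alpha> \<beta> = d x y" "reflection_dist d \<beta> \<alpha> = d y x"
      using reflection_dist_eq a b x y by blast+
    show "0 \<le> reflection_dist d \<alpha> \<beta>" using e nonneg x y by simp
    show "reflection_dist d \<alpha> \<beta> = reflection_dist d \<beta> \<alpha>" using e commute x y by simp
    show "reflection_dist d \<alpha> \<alpha> = 0" using reflection_dist_eq[OF a a x(1) x(1)] zero_refl x by simp
    show "\<alpha> = \<beta>" if "reflection_dist d \<alpha> \<beta> = 0"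
      using that e x y a b quotient_eq_iff[OF equiv_zero_rel, of \<alpha> \<beta> x y]
      by (simp add: reflection_def zero_rel_def)
    fix \<gamma> assume c: "\<gamma> \<in> reflection X d"
    obtain z where z: "z \<in> \<gamma>" "z \<in> X" using rep c by meson
    show "reflection_dist d \<alpha> \<gamma> \<le> reflection_dist d \<alpha> \<beta> + reflection_dist d \<beta> \<gamma>"
      using triangle[OF x(2) y(2) z(2)] reflection_dist_eq[OF a b x(1) y(1)]
        reflection_dist_eq[OF b c y(1) z(1)] reflection_dist_eq[OF a c x(1) z(1)] by linarith
  qed
qed

end

lemma subgroup_Cs: "subgroup (carrier (Cs X d)) (BijGroup X)"
proof -
  interpret group "BijGroup X" by (rule group_BijGroup)
  show ?thesis
  proof (rule subgroupI)
    show "carrier (Cs X d) \<subseteq> carrier (BijGroup X)" by (auto simp: Cs_def BijGroup_def)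
    have "comb_self_similarity X d (\<lambda>x\<in>X. x)"
      unfolding comb_self_similarity_def
      by (rule conjI, use id_Bij[of X] in \<open>simp add: Bij_def\<close>, rule exI[of _ id]) auto
    then show "carrier (Cs X d) \<noteq> {}" using id_Bij[of X] by (auto simp: Cs_def)
  next
    fix \<Psi> assume "\<Psi> \<in> carrier (Cs X d)"
    then have B: "\<Psi> \<in> Bij X" and "comb_self_similarity X d \<Psi>" by (auto simp: Cs_def)
    then obtain f where bij: "bij_betw \<Psi> X X" and f: "bij_betw f (dist_values X d) (dist_values X d)"
      and eq: "\<And>x y. x \<in> X \<Longrightarrow> y \<in> X \<Longrightarrow> d x y = f (d (\<Psi> x) (\<Psi> y))"
      unfolding comb_self_similarity_def by blast
    let ?D = "dist_values X d" and ?i = "restrict (inv_into X \<Psi>) X"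
    have iX: "inv_into X \<Psi> x \<in> X" "\<Psi> (inv_into X \<Psi> x) = x" if "x \<in> X" for x
      using that bij by (auto simp: bij_betw_def inv_into_into f_inv_into_f)
    have "d x y = inv_into ?D f (d (?i x) (?i y))" if "x \<in> X" "y \<in> X" for x y
    proof -
      have "d x y \<in> ?D" using that by (auto simp: dist_values_def)
      then show ?thesis using that eq[of "?i x" "?i y"] iX f by (simp add: bij_betw_def)
    qed
    then have "comb_self_similarity X d ?i"
      unfolding comb_self_similarity_def
      using bij_betw_inv_into[OF f] restrict_inv_into_Bij[OF B] unfolding Bij_def by blast
    then show "inv\<^bsub>BijGroup X\<^esub> \<Psi> \<in> carrier (Cs X d)"
      using B restrict_inv_into_Bij[OF B] by (simp add: inv_BijGroup Cs_def)
  next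
    fix \<Phi> \<Psi> assume "\<Phi> \<in> carrier (Cs X d)" "\<Psi> \<in> carrier (Cs X d)"
    then have B: "\<Phi> \<in> Bij X" "\<Psi> \<in> Bij X"
      and "comb_self_similarity X d \<Phi>" "comb_self_similarity X d \<Psi>" by (auto simp: Cs_def)
    then obtain f g where fg: "bij_betw f (dist_values X d) (dist_values X d)"
        "bij_betw g (dist_values X d) (dist_values X d)"
      and eq: "\<And>x y. x \<in> X \<Longrightarrow> y \<in> X \<Longrightarrow> d x y = f (d (\<Phi> x) (\<Phi> y))"
        "\<And>x y. x \<in> X \<Longrightarrow> y \<in> X \<Longrightarrow> d x y = g (d (\<Psi> x) (\<Psi> y))"
      unfolding comb_self_similarity_def by blast
    have "d x y = (g \<circ> f) (d (compose X \<Phi> \<Psi> x) (compose X \<Phi> \<Psi> y))" if "x \<in> X" "y \<in> X" for x y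
      using that eq(2)[of x y] eq(1)[of "\<Psi> x" "\<Psi> y"] Bij_imp_funcset[OF B(2)]
      by (auto simp: compose_def Pi_iff)
    then have "comb_self_similarity X d (compose X \<Phi> \<Psi>)"
      unfolding comb_self_similarity_def
      using bij_betw_trans[OF fg] compose_Bij[OF B] unfolding Bij_def by blast
    then show "\<Phi> \<otimes>\<^bsub>BijGroup X\<^esub> \<Psi> \<in> carrier (Cs X d)"
      using B compose_Bij[OF B] by (simp add: Cs_def BijGroup_def)
  qed
qed

end

theory Submission
  imports Defs "HOL-Combinatorics.Transposition"
begin

text \<open>A permutation is a combinatorial self-similarity iff it preserves the relation
  \<open>d x y = d u v\<close> between pairs of points. In a metric space this relation depends only on the
  coincidences between \<open>x, y, u, v\<close> when the space is strongly rigid, discrete or a rectangle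
  (where the equal distances are those of opposite edges), so all permutations preserve it.
  Conversely, suppose all permutations preserve it and the space is not strongly rigid. If two
  edges with a common vertex have equal length, moving them around by permutations makes all
  nonzero distances equal. Otherwise two disjoint edges have equal length; a fifth point could be
  swapped with an endpoint of one of them and would produce two equal edges with a common vertex,
  so there are exactly four points, and opposite edges have equal length. The three
  properties transfer between a pseudometric space and its metric reflection because the metric
  subspaces of the former project isometrically onto exactly the subsets of the latter.\<close>

section \<open>Self-similarities as permutations that preserve equality of distances\<close>

text \<open>This eliminates the bijection \<open>f\<close>: it can only send
  \<open>d (\<Psi> x) (\<Psi> y)\<close> to \<open>d x y\<close>, and the two directions of the
  equivalence make this assignment injective and well defined.\<close>

lemma comb_self_similarity_iff:
  assumes "bij_betw \<Psi> X X"
  shows "comb_self_similarity X d \<Psi> \<longleftrightarrow>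
    (\<forall>x\<in>X. \<forall>y\<in>X. \<forall>u\<in>X. \<forall>v\<in>X. d x y = d u v \<longleftrightarrow> d (\<Psi> x) (\<Psi> y) = d (\<Psi> u) (\<Psi> v))"
    (is "_ \<longleftrightarrow> ?R")
proof
  assume "comb_self_similarity X d \<Psi>"
  then obtain f where f: "bij_betw f (dist_values X d) (dist_values X d)"
    and eq: "\<And>x y. x \<in> X \<Longrightarrow> y \<in> X \<Longrightarrow> d x y = f (d (\<Psi> x) (\<Psi> y))"
    unfolding comb_self_similarity_def by blast
  have "d (\<Psi> x) (\<Psi> y) \<in> dist_values X d" if "x \<in> X" "y \<in> X" for x y
    using that assms by (auto simp: dist_values_def bij_betw_def)
  then show ?R
    using eq bij_betw_imp_inj_on[OF f] by (metis inj_on_eq_iff)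
next
  assume R: ?R
  have surj: "\<exists>x\<in>X. \<Psi> x = a" if "a \<in> X" for a
    using assms that by (metis bij_betw_imp_surj_on imageE)
  have into: "\<Psi> x \<in> X" if "x \<in> X" for x
    using assms that by (auto simp: bij_betw_def)
  \<comment> \<open>The direction from images back to points makes the value unique. Surjectivity of
    \<open>\<Psi>\<close> gives every distance the form \<open>d (\<Psi> x) (\<Psi> y)\<close>, so
    the value is determined on all of \<open>dist_values X d\<close>.\<close>
  define f where "f r = (THE s. \<exists>x\<in>X. \<exists>y\<in>X. r = d (\<Psi> x) (\<Psi> y) \<and> s = d x y)" for r
  have f: "f (d (\<Psi> x) (\<Psi> y)) = d x y" if "x \<in> X" "y \<in> X" for x y
    unfolding f_def
  proof (rule the_equality)
    show "\<exists>u\<in>X. \<exists>v\<in>X. d (\<Psi> x) (\<Psi> y) = d (\<Psi> u) (\<Psi> v) \<and> d x y = d u v"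
      using that by blast
    show "s = d x y"
      if "\<exists>u\<in>X. \<exists>v\<in>X. d (\<Psi> x) (\<Psi> y) = d (\<Psi> u) (\<Psi> v) \<and> s = d u v" for s
      using that R \<open>x \<in> X\<close> \<open>y \<in> X\<close> by metis
  qed
  have rep: "\<exists>x\<in>X. \<exists>y\<in>X. r = d (\<Psi> x) (\<Psi> y)" if "r \<in> dist_values X d" for r
    using that surj unfolding dist_values_def by blast
  \<comment> \<open>Here the other direction is used, from points to images.\<close>
  have "inj_on f (dist_values X d)"
  proof (rule inj_onI)
    fix r s assume rs: "r \<in> dist_values X d" "s \<in> dist_values X d" "f r = f s"
    obtain x y u v where "x \<in> X" "y \<in> X" "r = d (\<Psi> x) (\<Psi> y)" "u \<in> X" "v \<in> X" "s = d (\<Psi> u) (\<Psi> v)"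
      using rep rs by meson
    then show "r = s" using rs(3) f R by metis
  qed
  moreover have "f ` dist_values X d = dist_values X d"
  proof
    show "f ` dist_values X d \<subseteq> dist_values X d"
    proof
      fix s assume "s \<in> f ` dist_values X d"
      then obtain x y where "x \<in> X" "y \<in> X" "s = f (d (\<Psi> x) (\<Psi> y))" using rep by blast
      then show "s \<in> dist_values X d" using f by (auto simp: dist_values_def)
    qed
    show "dist_values X d \<subseteq> f ` dist_values X d"
    proof
      fix s assume "s \<in> dist_values X d"
      then obtain x y where xy: "x \<in> X" "y \<in> X" "s = d x y" by (auto simp: dist_values_def)
      then have "d (\<Psi> x) (\<Psi> y) \<in> dist_values X d" using into by (auto simp: dist_values_def)
      then show "s \<in> f ` dist_values X d" using f xy by (metis imageI)
    qed
  qed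
  ultimately show "comb_self_similarity X d \<Psi>"
    unfolding comb_self_similarity_def
    using assms f by (auto simp: bij_betw_def intro!: exI[of _ f])
qed

text \<open>Elements of \<open>BijGroup X\<close> are extensional, but the criterion sees only
  values on \<open>X\<close>. Restriction therefore lets \<open>\<Psi>\<close> range over all
  bijections, such as transpositions, which need not be extensional.\<close>

lemma Cs_eq_BijGroup_iff:
  "Cs X d = BijGroup X \<longleftrightarrow>
    (\<forall>\<Psi>. bij_betw \<Psi> X X \<longrightarrow>
      (\<forall>x\<in>X. \<forall>y\<in>X. \<forall>u\<in>X. \<forall>v\<in>X. d x y = d u v \<longleftrightarrow> d (\<Psi> x) (\<Psi> y) = d (\<Psi> u) (\<Psi> v)))"
    (is "_ \<longleftrightarrow> ?R")
proof -
  have "Cs X d = BijGroup X \<longleftrightarrow> (\<forall>\<Psi>\<in>Bij X. comb_self_similarity X d \<Psi>)"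
    by (auto simp: Cs_def BijGroup_def)
  also have "\<dots> \<longleftrightarrow> ?R"
  proof
    assume L: "\<forall>\<Psi>\<in>Bij X. comb_self_similarity X d \<Psi>"
    show ?R
    proof (intro allI impI)
      fix \<Psi> assume "bij_betw \<Psi> X X"
      then have b: "bij_betw (restrict \<Psi> X) X X" by simp
      then have "comb_self_similarity X d (restrict \<Psi> X)" using L by (simp add: Bij_def)
      then show "\<forall>x\<in>X. \<forall>y\<in>X. \<forall>u\<in>X. \<forall>v\<in>X. d x y = d u v \<longleftrightarrow> d (\<Psi> x) (\<Psi> y) = d (\<Psi> u) (\<Psi> v)"
        unfolding comb_self_similarity_iff[OF b] by simp
    qed
  next
    assume R: ?R
    show "\<forall>\<Psi>\<in>Bij X. comb_self_similarity X d \<Psi>"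
    proof
      fix \<Psi> assume "\<Psi> \<in> Bij X"
      then have b: "bij_betw \<Psi> X X" by (simp add: Bij_def)
      then show "comb_self_similarity X d \<Psi>" using R comb_self_similarity_iff[OF b] by blast
    qed
  qed
  finally show ?thesis .
qed

section \<open>Permutations with prescribed values\<close>

lemma bij_betw_transpose_carrier:
  assumes "a \<in> X" "b \<in> X"
  shows "bij_betw (transpose a b) X X"
  using assms by (intro bij_betw_byWitness[where f' = "transpose a b"]) (auto simp: transpose_def)

text \<open>Three transpositions suffice: each moves the current image of the next point to its
  target. Both points that it swaps differ from the targets already reached, so these stay
  fixed.\<close>

lemma ex_bij_betw_triple:
  assumes "a \<in> X" "b \<in> X" "c \<in> X" "a \<noteq> b" "a \<noteq> c" "b \<noteq> c"
    and "a' \<in> X" "b' \<in> X" "c' \<in> X" "a' \<noteq> b'" "a' \<noteq> c'" "b' \<noteq> c'"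
  shows "\<exists>\<Psi>. bij_betw \<Psi> X X \<and> \<Psi> a = a' \<and> \<Psi> b = b' \<and> \<Psi> c = c'"
proof -
  define f where "f = transpose a a'"
  define g where "g = transpose (f b) b'"
  define h where "h = transpose (g (f c)) c'"
  have "f b \<in> X" "f c \<in> X" using assms by (auto simp: f_def transpose_def)
  then have "g (f c) \<in> X" using assms by (auto simp: g_def transpose_def)
  then have "bij_betw (h \<circ> (g \<circ> f)) X X"
    using assms \<open>f b \<in> X\<close>
    by (intro bij_betw_trans[of _ X X]) (auto simp: f_def g_def h_def intro!: bij_betw_transpose_carrier)
  moreover have "f a = a'" by (simp add: f_def)
  moreover have "f b \<noteq> a'" "f c \<noteq> a'" "f b \<noteq> f c"
    using assms by (auto simp: f_def transpose_def split: if_splits)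
  moreover from this have "g a' = a'" "g (f b) = b'" "g (f c) \<noteq> a'" "g (f c) \<noteq> b'"
    using assms by (auto simp: g_def transpose_def split: if_splits)
  moreover from this have "h a' = a'" "h b' = b'" "h (g (f c)) = c'"
    using assms by (auto simp: h_def transpose_def)
  ultimately show ?thesis by (intro exI[of _ "h \<circ> (g \<circ> f)"]) simp
qed

section \<open>Equality of distances in the three kinds of metric spaces\<close>

lemma isometric_dist_values:
  assumes "isometric Y Z d"
  shows "dist_values Y d = dist_values Z d"
proof -
  obtain g where g: "g ` Y = Z" "\<forall>x\<in>Y. \<forall>y\<in>Y. d (g x) (g y) = d x y"
    using assms by (auto simp: isometric_def bij_betw_def)
  show ?thesis
  proof
    show "dist_values Y d \<subseteq> dist_values Z d"
    proof
      fix r assume "r \<in> dist_values Y d"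
      then obtain x y where "x \<in> Y" "y \<in> Y" "r = d x y" by (auto simp: dist_values_def)
      then have "r = d (g x) (g y)" "g x \<in> Z" "g y \<in> Z" using g by auto
      then show "r \<in> dist_values Z d" by (auto simp: dist_values_def)
    qed
    show "dist_values Z d \<subseteq> dist_values Y d"
      using g by (fastforce simp: dist_values_def)
  qed
qed

text \<open>The form that \<open>pseudorectangle\<close> takes in a metric space: every subset is a
  metric subspace, and the four-point subspace has to be the whole space.\<close>

definition metric_rectangle :: "'a set \<Rightarrow> ('a \<Rightarrow> 'a \<Rightarrow> real) \<Rightarrow> bool"
  where "metric_rectangle X d \<longleftrightarrow>
    card X = 4 \<and>
    (\<forall>Y\<subseteq>X. card Y = 3 \<longrightarrow> strongly_rigid_metric Y d) \<and>
    (\<forall>Y\<subseteq>X. \<forall>Z\<subseteq>X. card Y = 3 \<longrightarrow> card Z = 3 \<longrightarrow> isometric Y Z d)"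

context metric_space_on
begin

lemma dist_eq_0_iff: "x \<in> X \<Longrightarrow> y \<in> X \<Longrightarrow> d x y = 0 \<longleftrightarrow> x = y"
  using zero_imp_eq zero_refl by blast

text \<open>The right-hand side mentions only coincidences between points, so injective maps
  preserve it. The analogues for discrete spaces and rectangles serve the same purpose.\<close>

lemma strongly_rigid_dist_eq_iff:
  assumes "strongly_rigid_metric X d" "x \<in> X" "y \<in> X" "u \<in> X" "v \<in> X"
  shows "d x y = d u v \<longleftrightarrow> (x = y \<and> u = v) \<or> {x, y} = {u, v}"
proof (cases "d u v = 0")
  case True
  then show ?thesis using assms(2-) dist_eq_0_iff by (metis doubleton_eq_iff)
next
  case False
  then show ?thesis
    using assms commute[of x y] dist_eq_0_iff[of u v]
    unfolding strongly_rigid_metric_def by (auto simp: doubleton_eq_iff)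
qed

text \<open>Two different nonzero distances would, together with 0, make three values.\<close>

lemma discrete_dist_eq_iff:
  assumes "discrete_metric X d" "x \<in> X" "y \<in> X" "u \<in> X" "v \<in> X"
  shows "d x y = d u v \<longleftrightarrow> (x = y \<longleftrightarrow> u = v)"
proof -
  have "d x y = d u v" if "x \<noteq> y" "u \<noteq> v"
  proof (rule ccontr)
    assume "d x y \<noteq> d u v"
    then have "card {0, d x y, d u v} = 3"
      using that assms dist_eq_0_iff by (auto simp: card_insert_if)
    moreover have "{0, d x y, d u v} \<subseteq> dist_values X d"
      using assms zero_refl[of x] unfolding dist_values_def by force
    ultimately have "3 \<le> card (dist_values X d)"
      using assms(1) card_mono unfolding discrete_metric_def by metis
    then show False using assms(1) by (simp add: discrete_metric_def)
  qed
  then show ?thesis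
    using dist_eq_0_iff[OF assms(2,3)] dist_eq_0_iff[OF assms(4,5)] by metis
qed

lemma metric_rectangle_dist_eq_iff:
  assumes R: "metric_rectangle X d" and X: "x \<in> X" "y \<in> X" "u \<in> X" "v \<in> X"
  shows "d x y = d u v \<longleftrightarrow>
    (x = y \<and> u = v) \<or> (x \<noteq> y \<and> u \<noteq> v \<and> ({x, y} = {u, v} \<or> {x, y} \<inter> {u, v} = {}))"
proof -
  \<comment> \<open>Two edges with a common vertex lie in one triangle, which is strongly
    rigid.\<close>
  have adj: "d a b \<noteq> d a c"
    if abc: "a \<in> X" "b \<in> X" "c \<in> X" "a \<noteq> b" "a \<noteq> c" "b \<noteq> c" for a b c
  proof -
    have "strongly_rigid_metric {a, b, c} d"
      using R abc unfolding metric_rectangle_def by simp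
    then have "d a b = d a c \<and> d a c \<noteq> 0 \<longrightarrow> {a, b} = {a, c}"
      unfolding strongly_rigid_metric_def by blast
    then show ?thesis using abc dist_eq_0_iff[of a c] by (auto simp: doubleton_eq_iff)
  qed
  \<comment> \<open>By isometry of the two triangles, \<open>d c e\<close> is a side length of the
    triangle \<open>a\<close>, \<open>b\<close>, \<open>c\<close>. The sides \<open>b c\<close> and
    \<open>a c\<close> share the vertex \<open>c\<close> with \<open>c e\<close>, so
    \<open>adj\<close> leaves only \<open>d a b\<close>.\<close>
  have opp: "d a b = d c e"
    if ab: "a \<in> X" "b \<in> X" "c \<in> X" "e \<in> X" "distinct [a, b, c, e]" for a b c e
  proof -
    have "isometric {a, c, e} {a, b, c} d"
      using R ab unfolding metric_rectangle_def by simp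
    then have "dist_values {a, c, e} d = dist_values {a, b, c} d"
      by (rule isometric_dist_values)
    moreover have "d c e \<in> dist_values {a, c, e} d"
      unfolding dist_values_def by blast
    ultimately have "d c e \<in> dist_values {a, b, c} d" by simp
    then have "d c e \<in> {0, d a b, d b c, d a c}"
      using ab zero_refl commute by (auto simp: dist_values_def)
    moreover have "d c e \<noteq> 0" using ab dist_eq_0_iff by simp
    moreover have "d c e \<noteq> d b c" "d c e \<noteq> d a c"
      using adj[of c e b] adj[of c e a] ab commute by auto
    ultimately show ?thesis by auto
  qed
  show ?thesis
  proof (cases "x = y \<or> u = v")
    case True
    then show ?thesis
      using dist_eq_0_iff[OF X(1,2)] dist_eq_0_iff[OF X(3,4)] by auto
  next
    case False
    show ?thesis
    proof (cases "{x, y} \<inter> {u, v} = {}")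
      case True
      then show ?thesis using False opp[of x y u v] X by auto
    next
      case inter: False
      have "d x y \<noteq> d u v" if "{x, y} \<noteq> {u, v}"
        using inter that False X commute adj[of x y u] adj[of x y v] adj[of y x u] adj[of y x v]
        by (auto simp: doubleton_eq_iff)
      then show ?thesis using False inter X commute by (auto simp: doubleton_eq_iff)
    qed
  qed
qed

text \<open>Edges \<open>a b\<close> and \<open>u v\<close> without common first vertex are compared
  through the edge \<open>a u\<close>, which meets both.\<close>

lemma discrete_if_all_isosceles:
  assumes iso: "\<And>a b c. \<lbrakk>a \<in> X; b \<in> X; c \<in> X; a \<noteq> b; a \<noteq> c\<rbrakk> \<Longrightarrow> d a b = d a c"
  shows "discrete_metric X d"
proof -
  have eq: "d a b = d u v" if "a \<in> X" "b \<in> X" "u \<in> X" "v \<in> X" "a \<noteq> b" "u \<noteq> v" for a b u v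
  proof (cases "a = u")
    case True
    then show ?thesis using iso that by blast
  next
    case False
    then show ?thesis using iso[of a b u] iso[of u a v] commute[of a u] that by auto
  qed
  have "\<exists>r. dist_values X d \<subseteq> {0, r}"
  proof (cases "\<exists>a\<in>X. \<exists>b\<in>X. a \<noteq> b")
    case True
    then obtain a b where ab: "a \<in> X" "b \<in> X" "a \<noteq> b" by blast
    have "d u v \<in> {0, d a b}" if "u \<in> X" "v \<in> X" for u v
      using eq[of u v a b] zero_refl[of u] that ab by (cases "u = v") auto
    then show ?thesis by (auto simp: dist_values_def intro!: exI[of _ "d a b"])
  next
    case False
    then have "dist_values X d \<subseteq> {0, 0}" using zero_refl by (fastforce simp: dist_values_def)
    then show ?thesis by blast
  qed
  then obtain r where r: "dist_values X d \<subseteq> {0, r}" by blast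
  have "card (dist_values X d) \<le> card {0, r}" by (rule card_mono[OF _ r]) simp
  also have "\<dots> \<le> 2" by (simp add: card_insert_if)
  finally show ?thesis using finite_subset[OF r] by (simp add: discrete_metric_def)
qed

text \<open>Each triangle omits one of the four points. Scalene triangles are strongly rigid, and
  equality of opposite sides makes any two triangles isometric.\<close>

lemma metric_rectangle_if_opposite_sides:
  assumes card: "card X = 4"
    and scalene: "\<And>a b c. \<lbrakk>a \<in> X; b \<in> X; c \<in> X; a \<noteq> b; a \<noteq> c; b \<noteq> c\<rbrakk> \<Longrightarrow> d a b \<noteq> d a c"
    and opp: "\<And>a b c e. \<lbrakk>a \<in> X; b \<in> X; c \<in> X; e \<in> X; distinct [a, b, c, e]\<rbrakk> \<Longrightarrow> d a b = d c e"
  shows "metric_rectangle X d"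
  unfolding metric_rectangle_def
proof (intro conjI allI impI)
  show "card X = 4" by (rule card)
  have fin: "finite X" using card card.infinite by fastforce
  show "strongly_rigid_metric Y d" if Y: "Y \<subseteq> X" "card Y = 3" for Y
  proof -
    obtain a b c where abc: "Y = {a, b, c}" "a \<noteq> b" "b \<noteq> c" "a \<noteq> c"
      using Y(2) unfolding card_3_iff by blast
    then have X: "a \<in> X" "b \<in> X" "c \<in> X" using Y by auto
    then have "d a a = 0" "d b b = 0" "d c c = 0" using zero_refl by auto
    then show ?thesis
      using X abc scalene[of a b c] scalene[of b a c] scalene[of c a b] commute
      unfolding strongly_rigid_metric_def by auto
  qed
  show "isometric Y Z d" if Y: "Y \<subseteq> X" "card Y = 3" and Z: "Z \<subseteq> X" "card Z = 3" for Y Z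
  proof -
    \<comment> \<open>\<open>p\<close> and \<open>q\<close> are the omitted points; if they differ,
      the remaining points \<open>r\<close> and \<open>s\<close> belong to both triangles.\<close>
    have "card (X - Y) = 1" "card (X - Z) = 1"
      using Y Z card finite_subset[OF _ fin] by (simp_all add: card_Diff_subset)
    then obtain p q where p: "X - Y = {p}" and q: "X - Z = {q}"
      by (meson card_1_singletonE)
    show ?thesis
    proof (cases "p = q")
      case True
      then have "Y = Z" using p q Y(1) Z(1) by blast
      then show ?thesis unfolding isometric_def by (intro exI[of _ id]) auto
    next
      case False
      have "p \<in> X" "q \<in> X" using p q by blast+
      then have "card (X - {p, q}) = 2"
        using False card fin by (simp add: card_Diff_subset)
      then obtain r s where rs: "X - {p, q} = {r, s}" "r \<noteq> s" by (meson card_2_iff)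
      have mem: "p \<in> X" "q \<in> X" "r \<in> X" "s \<in> X" using \<open>p \<in> X\<close> \<open>q \<in> X\<close> rs by blast+
      have dist: "distinct [p, q, r, s]" using False rs by auto
      have "X = insert p (insert q {r, s})" using rs mem by blast
      moreover have "Y = X - {p}" "Z = X - {q}" using p q Y(1) Z(1) by blast+
      ultimately have YZ: "Y = {q, r, s}" "Z = {p, r, s}" using dist by auto
      \<comment> \<open>The product of two disjoint transpositions is an isometry of the rectangle.\<close>
      define g where "g = transpose p q \<circ> transpose r s"
      have g: "g q = p" "g r = s" "g s = r"
        using dist by (auto simp: g_def transpose_def)
      have "bij_betw g Y Z" using g dist YZ by (auto simp: bij_betw_def inj_on_def)
      \<comment> \<open>The sides \<open>q r\<close> and \<open>q s\<close> go to their opposite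
        sides \<open>p s\<close> and \<open>p r\<close>, while \<open>r s\<close> is only
        reversed.\<close>
      moreover have "\<forall>x\<in>Y. \<forall>y\<in>Y. d (g x) (g y) = d x y"
        using opp[of p s q r] opp[of p r q s] g mem dist YZ commute zero_refl by auto
      ultimately show ?thesis unfolding isometric_def by blast
    qed
  qed
qed

section \<open>The equivalence for metric spaces\<close>

lemma Cs_eq_BijGroup_iff_metric:
  "Cs X d = BijGroup X \<longleftrightarrow>
    strongly_rigid_metric X d \<or> discrete_metric X d \<or> metric_rectangle X d"
proof
  assume R: "strongly_rigid_metric X d \<or> discrete_metric X d \<or> metric_rectangle X d"
  show "Cs X d = BijGroup X"
    unfolding Cs_eq_BijGroup_iff
  proof (intro allI impI ballI)
    fix \<Psi> x y u v
    assume b: "bij_betw \<Psi> X X" and X: "x \<in> X" "y \<in> X" "u \<in> X" "v \<in> X"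
    have X': "\<Psi> x \<in> X" "\<Psi> y \<in> X" "\<Psi> u \<in> X" "\<Psi> v \<in> X"
      using b X by (auto simp: bij_betw_def)
    have inj: "\<Psi> a = \<Psi> b \<longleftrightarrow> a = b" if "a \<in> X" "b \<in> X" for a b
      using bij_betw_imp_inj_on[OF b] that by (rule inj_on_eq_iff)
    show "d x y = d u v \<longleftrightarrow> d (\<Psi> x) (\<Psi> y) = d (\<Psi> u) (\<Psi> v)"
      using R
    proof (elim disjE)
      assume S: "strongly_rigid_metric X d"
      show ?thesis
        unfolding strongly_rigid_dist_eq_iff[OF S X] strongly_rigid_dist_eq_iff[OF S X']
        by (simp add: doubleton_eq_iff inj X)
    next
      assume D: "discrete_metric X d"
      show ?thesis
        unfolding discrete_dist_eq_iff[OF D X] discrete_dist_eq_iff[OF D X']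
        by (simp add: inj X)
    next
      assume M: "metric_rectangle X d"
      show ?thesis
        unfolding metric_rectangle_dist_eq_iff[OF M X] metric_rectangle_dist_eq_iff[OF M X']
        by (simp add: doubleton_eq_iff inj X)
    qed
  qed
next
  assume "Cs X d = BijGroup X"
  then have perm: "d (\<Psi> x) (\<Psi> y) = d (\<Psi> u) (\<Psi> v)"
    if "d x y = d u v" "bij_betw \<Psi> X X" "x \<in> X" "y \<in> X" "u \<in> X" "v \<in> X" for \<Psi> x y u v
    using that unfolding Cs_eq_BijGroup_iff by blast
  show "strongly_rigid_metric X d \<or> discrete_metric X d \<or> metric_rectangle X d"
  proof (cases "\<exists>a\<in>X. \<exists>b\<in>X. \<exists>c\<in>X. a \<noteq> b \<and> a \<noteq> c \<and> b \<noteq> c \<and> d a b = d a c")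
    case True
    then obtain a b c where abc: "a \<in> X" "b \<in> X" "c \<in> X" "a \<noteq> b" "a \<noteq> c" "b \<noteq> c" "d a b = d a c"
      by blast
    have "d x y = d x z" if xyz: "x \<in> X" "y \<in> X" "z \<in> X" "x \<noteq> y" "x \<noteq> z" for x y z
    proof (cases "y = z")
      case False
      then obtain \<Psi> where "bij_betw \<Psi> X X" "\<Psi> a = x" "\<Psi> b = y" "\<Psi> c = z"
        using ex_bij_betw_triple[of a X b c x y z] abc xyz by blast
      then show ?thesis using perm[OF abc(7)] abc by auto
    qed simp
    then show ?thesis using discrete_if_all_isosceles by blast
  next
    case False
    then have scalene: "d a b \<noteq> d a c"
      if "a \<in> X" "b \<in> X" "c \<in> X" "a \<noteq> b" "a \<noteq> c" "b \<noteq> c" for a b c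
      using that by blast
    show ?thesis
    proof (cases "strongly_rigid_metric X d")
      case False
      then obtain x y u v where X: "x \<in> X" "y \<in> X" "u \<in> X" "v \<in> X"
        and eq: "d x y = d u v" and nz: "d u v \<noteq> 0" and ne: "{x, y} \<noteq> {u, v}"
        unfolding strongly_rigid_metric_def by blast
      have "x \<noteq> y" "u \<noteq> v" using X eq nz zero_refl by auto
      \<comment> \<open>If the two edges shared a vertex, they would be different edges of equal
        length at it, against \<open>scalene\<close>. The four instances cover the possible
        coincidences.\<close>
      then have dist: "distinct [x, y, u, v]"
        using X eq ne commute scalene[of x y u] scalene[of x y v] scalene[of y x u] scalene[of y x v]
        by (auto simp: doubleton_eq_iff)
      \<comment> \<open>Swapping \<open>u\<close> with a fifth point \<open>w\<close> fixes
        \<open>x\<close>, \<open>y\<close> and \<open>v\<close>, hence gives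
        \<open>d w v = d x y = d u v\<close>: two equal edges at \<open>v\<close>.\<close>
      have four: "X = {x, y, u, v}"
      proof (rule ccontr)
        assume "X \<noteq> {x, y, u, v}"
        then obtain w where w: "w \<in> X" "w \<notin> {x, y, u, v}" using X by blast
        have "d x y = d w v"
          using perm[OF eq bij_betw_transpose_carrier[OF X(3) w(1)] X] w dist
          by (auto simp: transpose_def)
        then show False using eq scalene[of v u w] commute X w dist by auto
      qed
      have opp: "d a b = d c e"
        if ab: "a \<in> X" "b \<in> X" "c \<in> X" "e \<in> X" "distinct [a, b, c, e]" for a b c e
      proof -
        \<comment> \<open>Prescribing three values is enough: \<open>e\<close> is the only point
          left for \<open>v\<close>.\<close>
        obtain \<Psi> where \<Psi>: "bij_betw \<Psi> X X" "\<Psi> x = a" "\<Psi> y = b" "\<Psi> u = c"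
          using ex_bij_betw_triple[of x X y u a b c] X ab dist by auto
        have "\<Psi> v = e"
        proof -
          have "e \<in> \<Psi> ` X" using \<Psi>(1) ab(4) by (simp add: bij_betw_def)
          then show ?thesis using four \<Psi> ab(5) by auto
        qed
        then show ?thesis using perm[OF eq \<Psi>(1) X] \<Psi> by simp
      qed
      have "card X = 4" using dist by (simp add: four)
      then show ?thesis using metric_rectangle_if_opposite_sides scalene opp by blast
    qed simp
  qed
qed

end

section \<open>Transfer along a distance-preserving surjection onto a metric space\<close>

text \<open>Abstracts the quotient map onto the metric reflection, so that the transfer never
  handles equivalence classes.\<close>

locale metric_projection = pseudometric_space X d + M: metric_space_on M \<delta>
  for X :: "'a set" and d and M :: "'b set" and \<delta> +
  fixes \<pi> :: "'a \<Rightarrow> 'b"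
  assumes onto: "\<pi> ` X = M"
    and dist: "\<lbrakk>x \<in> X; y \<in> X\<rbrakk> \<Longrightarrow> \<delta> (\<pi> x) (\<pi> y) = d x y"
begin

lemma dist_eq_0_iff: "x \<in> X \<Longrightarrow> y \<in> X \<Longrightarrow> d x y = 0 \<longleftrightarrow> \<pi> x = \<pi> y"
  using M.dist_eq_0_iff[of "\<pi> x" "\<pi> y"] dist onto by auto

text \<open>Points at distance 0 are exactly those in one fibre of \<open>\<pi>\<close>, so a metric
  subspace meets each fibre at most once.\<close>

lemma metric_subspace_iff: "metric_subspace Y X d \<longleftrightarrow> Y \<subseteq> X \<and> inj_on \<pi> Y"
proof (cases "Y \<subseteq> X")
  case True
  have "pseudometric_space Y d"
    using True by unfold_locales (auto simp: nonneg zero_refl triangle subset_iff intro: commute)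
  then have "metric_space_on Y d \<longleftrightarrow> (\<forall>x\<in>Y. \<forall>y\<in>Y. d x y = 0 \<longrightarrow> x = y)"
    by (auto simp: metric_space_on_def metric_space_on_axioms_def)
  then show ?thesis
    using True dist_eq_0_iff by (auto simp: metric_subspace_def inj_on_def subset_iff)
qed (simp add: metric_subspace_def)

text \<open>Choosing one preimage for each point of a subset of \<open>M\<close> yields a metric
  subspace over it.\<close>

lemma image_metric_subspaces: "(`) \<pi> ` {Y. metric_subspace Y X d} = Pow M"
proof
  show "(`) \<pi> ` {Y. metric_subspace Y X d} \<subseteq> Pow M"
    using onto by (auto simp: metric_subspace_iff)
  show "Pow M \<subseteq> (`) \<pi> ` {Y. metric_subspace Y X d}"
  proof
    fix Z assume "Z \<in> Pow M"
    then have "Z \<subseteq> \<pi> ` X" using onto by auto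
    then obtain Y where "Y \<subseteq> X" "inj_on \<pi> Y" "Z = \<pi> ` Y"
      by (meson subset_image_inj)
    then show "Z \<in> (`) \<pi> ` {Y. metric_subspace Y X d}" by (auto simp: metric_subspace_iff)
  qed
qed

text \<open>Moves quantifiers over metric subspaces to \<open>M\<close>, once the property is
  expressed through the image.\<close>

lemma all_metric_subspaces_iff:
  "(\<forall>Y. metric_subspace Y X d \<longrightarrow> P (\<pi> ` Y)) \<longleftrightarrow> (\<forall>Z\<subseteq>M. P Z)"
proof -
  have "(\<forall>Z\<subseteq>M. P Z) \<longleftrightarrow> (\<forall>Z\<in>(`) \<pi> ` {Y. metric_subspace Y X d}. P Z)"
    unfolding image_metric_subspaces by blast
  then show ?thesis by simp
qed

lemma card_image_metric_subspace: "metric_subspace Y X d \<Longrightarrow> card (\<pi> ` Y) = card Y"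
  by (simp add: metric_subspace_iff card_image)

lemma strongly_rigid_metric_image:
  assumes "metric_subspace Y X d"
  shows "strongly_rigid_metric (\<pi> ` Y) \<delta> \<longleftrightarrow> strongly_rigid_metric Y d"
proof -
  have Y: "Y \<subseteq> X" "inj_on \<pi> Y" using assms by (auto simp: metric_subspace_iff)
  have "{\<pi> x, \<pi> y} = {\<pi> u, \<pi> v} \<longleftrightarrow> {x, y} = {u, v}"
    if "x \<in> Y" "y \<in> Y" "u \<in> Y" "v \<in> Y" for x y u v
    using inj_on_image_eq_iff[OF Y(2), of "{x, y}" "{u, v}"] that by simp
  moreover have "\<delta> (\<pi> x) (\<pi> y) = d x y" if "x \<in> Y" "y \<in> Y" for x y
    using Y that dist by auto
  ultimately show ?thesis by (simp add: strongly_rigid_metric_def)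
qed

lemma dist_values_image:
  assumes "Y \<subseteq> X"
  shows "dist_values (\<pi> ` Y) \<delta> = dist_values Y d"
proof -
  have "\<delta> (\<pi> x) (\<pi> y) = d x y" if "x \<in> Y" "y \<in> Y" for x y
    using assms that dist by auto
  then show ?thesis by (force simp: dist_values_def)
qed

lemma isometric_image:
  assumes "metric_subspace Y X d" "metric_subspace Z X d"
  shows "isometric (\<pi> ` Y) (\<pi> ` Z) \<delta> \<longleftrightarrow> isometric Y Z d"
proof -
  have Y: "Y \<subseteq> X" "bij_betw \<pi> Y (\<pi> ` Y)" and Z: "Z \<subseteq> X" "bij_betw \<pi> Z (\<pi> ` Z)"
    using assms by (auto simp: metric_subspace_iff bij_betw_def)
  \<comment> \<open>On metric subspaces \<open>\<pi>\<close> is injective. Isometries are carried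
    over by composing with \<open>\<pi>\<close> and its inverses \<open>\<sigma>\<close> on
    \<open>Y\<close> and \<open>\<tau>\<close> on \<open>Z\<close>.\<close>
  define \<sigma> where "\<sigma> = inv_into Y \<pi>"
  define \<tau> where "\<tau> = inv_into Z \<pi>"
  have \<sigma>: "bij_betw \<sigma> (\<pi> ` Y) Y" and \<tau>: "bij_betw \<tau> (\<pi> ` Z) Z"
    unfolding \<sigma>_def \<tau>_def using bij_betw_inv_into Y Z by blast+
  have \<sigma>Y: "\<sigma> (\<pi> y) = y" if "y \<in> Y" for y
    using that Y by (simp add: \<sigma>_def bij_betw_def)
  have \<tau>Z: "\<tau> w \<in> Z" "\<pi> (\<tau> w) = w" if "w \<in> \<pi> ` Z" for w
    using that by (auto simp: \<tau>_def inv_into_into f_inv_into_f)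
  show ?thesis
  proof
    assume "isometric Y Z d"
    then obtain g where g: "bij_betw g Y Z" "\<forall>x\<in>Y. \<forall>y\<in>Y. d (g x) (g y) = d x y"
      by (auto simp: isometric_def)
    have "bij_betw (\<pi> \<circ> (g \<circ> \<sigma>)) (\<pi> ` Y) (\<pi> ` Z)"
      using \<sigma> g(1) Z(2) by (meson bij_betw_trans)
    moreover have "\<delta> (\<pi> (g (\<sigma> (\<pi> x)))) (\<pi> (g (\<sigma> (\<pi> y)))) = \<delta> (\<pi> x) (\<pi> y)"
      if "x \<in> Y" "y \<in> Y" for x y
    proof -
      have "g x \<in> X" "g y \<in> X" "x \<in> X" "y \<in> X"
        using that g(1) Y(1) Z(1) by (auto simp: bij_betw_def)
      then show ?thesis using that g(2) \<sigma>Y dist by simp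
    qed
    ultimately show "isometric (\<pi> ` Y) (\<pi> ` Z) \<delta>"
      unfolding isometric_def by (intro exI[of _ "\<pi> \<circ> (g \<circ> \<sigma>)"]) auto
  next
    assume "isometric (\<pi> ` Y) (\<pi> ` Z) \<delta>"
    then obtain g where g: "bij_betw g (\<pi> ` Y) (\<pi> ` Z)"
      "\<forall>x\<in>\<pi> ` Y. \<forall>y\<in>\<pi> ` Y. \<delta> (g x) (g y) = \<delta> x y"
      by (auto simp: isometric_def)
    have "bij_betw (\<tau> \<circ> (g \<circ> \<pi>)) Y Z"
      using Y(2) g(1) \<tau> by (meson bij_betw_trans)
    moreover have "d (\<tau> (g (\<pi> x))) (\<tau> (g (\<pi> y))) = d x y" if "x \<in> Y" "y \<in> Y" for x y
    proof -
      have gx: "g (\<pi> x) \<in> \<pi> ` Z" "g (\<pi> y) \<in> \<pi> ` Z"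
        using that g(1) by (auto simp: bij_betw_def)
      have "d (\<tau> (g (\<pi> x))) (\<tau> (g (\<pi> y))) = \<delta> (g (\<pi> x)) (g (\<pi> y))"
        using dist[of "\<tau> (g (\<pi> x))" "\<tau> (g (\<pi> y))"] \<tau>Z[OF gx(1)] \<tau>Z[OF gx(2)] Z(1)
        by (simp add: subset_iff)
      also have "\<dots> = d x y"
        using g(2) that Y(1) dist by (simp add: subset_iff)
      finally show ?thesis .
    qed
    ultimately show "isometric Y Z d"
      unfolding isometric_def by (intro exI[of _ "\<tau> \<circ> (g \<circ> \<pi>)"]) auto
  qed
qed

text \<open>Strong rigidity is inherited by subsets, so the condition on all subsets of
  \<open>M\<close> reduces to \<open>M\<close> itself. Discreteness is treated in the same
  way.\<close>

lemma strongly_rigid_iff: "strongly_rigid X d \<longleftrightarrow> strongly_rigid_metric M \<delta>"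
proof -
  have "strongly_rigid X d \<longleftrightarrow>
      (\<forall>Y. metric_subspace Y X d \<longrightarrow> strongly_rigid_metric (\<pi> ` Y) \<delta>)"
    using strongly_rigid_metric_image by (auto simp: strongly_rigid_def)
  also have "\<dots> \<longleftrightarrow> (\<forall>Z\<subseteq>M. strongly_rigid_metric Z \<delta>)"
    by (rule all_metric_subspaces_iff)
  also have "\<dots> \<longleftrightarrow> strongly_rigid_metric M \<delta>"
    unfolding strongly_rigid_metric_def by blast
  finally show ?thesis .
qed

lemma discrete_pseudometric_iff: "discrete_pseudometric X d \<longleftrightarrow> discrete_metric M \<delta>"
proof -
  have "discrete_pseudometric X d \<longleftrightarrow>
      (\<forall>Y. metric_subspace Y X d \<longrightarrow> discrete_metric (\<pi> ` Y) \<delta>)"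
    using dist_values_image
    by (auto simp: discrete_pseudometric_def discrete_metric_def metric_subspace_def)
  also have "\<dots> \<longleftrightarrow> (\<forall>Z\<subseteq>M. discrete_metric Z \<delta>)"
    by (rule all_metric_subspaces_iff)
  also have "\<dots> \<longleftrightarrow> discrete_metric M \<delta>"
  proof
    assume M: "discrete_metric M \<delta>"
    show "\<forall>Z\<subseteq>M. discrete_metric Z \<delta>"
    proof (intro allI impI)
      fix Z assume "Z \<subseteq> M"
      then have "dist_values Z \<delta> \<subseteq> dist_values M \<delta>" by (auto simp: dist_values_def)
      then show "discrete_metric Z \<delta>"
        using M unfolding discrete_metric_def by (meson card_mono finite_subset le_trans)
    qed
  qed simp
  finally show ?thesis .
qed

lemma pseudorectangle_iff: "pseudorectangle X d \<longleftrightarrow> metric_rectangle M \<delta>"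
proof -
  have "(\<forall>Y. metric_subspace Y X d \<and> card Y = 3 \<longrightarrow> strongly_rigid_metric Y d) \<longleftrightarrow>
      (\<forall>Y. metric_subspace Y X d \<longrightarrow> card (\<pi> ` Y) = 3 \<longrightarrow> strongly_rigid_metric (\<pi> ` Y) \<delta>)"
    by (auto simp: card_image_metric_subspace strongly_rigid_metric_image)
  also have "\<dots> \<longleftrightarrow> (\<forall>Z\<subseteq>M. card Z = 3 \<longrightarrow> strongly_rigid_metric Z \<delta>)"
    by (rule all_metric_subspaces_iff)
  finally have 1: "(\<forall>Y. metric_subspace Y X d \<and> card Y = 3 \<longrightarrow> strongly_rigid_metric Y d) \<longleftrightarrow>
      (\<forall>Z\<subseteq>M. card Z = 3 \<longrightarrow> strongly_rigid_metric Z \<delta>)" .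
  have "(\<forall>Y Z. metric_subspace Y X d \<and> card Y = 3 \<and> metric_subspace Z X d \<and> card Z = 3
        \<longrightarrow> isometric Y Z d) \<longleftrightarrow>
      (\<forall>Y. metric_subspace Y X d \<longrightarrow> (\<forall>Z. metric_subspace Z X d \<longrightarrow>
        card (\<pi> ` Y) = 3 \<longrightarrow> card (\<pi> ` Z) = 3 \<longrightarrow> isometric (\<pi> ` Y) (\<pi> ` Z) \<delta>))"
    by (auto simp: card_image_metric_subspace isometric_image)
  also have "\<dots> \<longleftrightarrow> (\<forall>Y\<subseteq>M. \<forall>Z\<subseteq>M. card Y = 3 \<longrightarrow> card Z = 3 \<longrightarrow> isometric Y Z \<delta>)"
    \<comment> \<open>The inner quantifier is moved to \<open>M\<close> with \<open>Y\<close> fixed;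
      what remains depends on \<open>Y\<close> only through its image, so the outer one can
      follow.\<close>
    by (simp only: all_metric_subspaces_iff[of "\<lambda>Z. card (\<pi> ` Y) = 3 \<longrightarrow> card Z = 3 \<longrightarrow>
          isometric (\<pi> ` Y) Z \<delta>" for Y]
        all_metric_subspaces_iff[of "\<lambda>Y. \<forall>Z\<subseteq>M. card Y = 3 \<longrightarrow> card Z = 3 \<longrightarrow> isometric Y Z \<delta>"])
  finally have 2: "(\<forall>Y Z. metric_subspace Y X d \<and> card Y = 3 \<and> metric_subspace Z X d \<and> card Z = 3
        \<longrightarrow> isometric Y Z d) \<longleftrightarrow>
      (\<forall>Y\<subseteq>M. \<forall>Z\<subseteq>M. card Y = 3 \<longrightarrow> card Z = 3 \<longrightarrow> isometric Y Z \<delta>)" .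
  \<comment> \<open>Having a point of \<open>Y\<close> at distance 0 from each point means meeting
    every fibre.\<close>
  have "(\<forall>x\<in>X. \<exists>y\<in>Y. d x y = 0) \<longleftrightarrow> \<pi> ` Y = M" if "metric_subspace Y X d" for Y
  proof -
    have "Y \<subseteq> X" using that by (simp add: metric_subspace_iff)
    then have "(\<forall>x\<in>X. \<exists>y\<in>Y. d x y = 0) \<longleftrightarrow> (\<forall>x\<in>X. \<pi> x \<in> \<pi> ` Y)"
      using dist_eq_0_iff by (auto simp: image_iff subset_iff)
    then show ?thesis using onto \<open>Y \<subseteq> X\<close> by blast
  qed
  \<comment> \<open>The existential is written as a negated universal to fit
    \<open>all_metric_subspaces_iff\<close>.\<close>
  then have "(\<exists>Y. metric_subspace Y X d \<and> card Y = 4 \<and> (\<forall>x\<in>X. \<exists>y\<in>Y. d x y = 0)) \<longleftrightarrow>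
      \<not> (\<forall>Y. metric_subspace Y X d \<longrightarrow> \<not> (card (\<pi> ` Y) = 4 \<and> \<pi> ` Y = M))"
    using card_image_metric_subspace by auto
  also have "\<dots> \<longleftrightarrow> \<not> (\<forall>Z\<subseteq>M. \<not> (card Z = 4 \<and> Z = M))"
    using all_metric_subspaces_iff[of "\<lambda>Z. \<not> (card Z = 4 \<and> Z = M)"] by (rule arg_cong)
  also have "\<dots> \<longleftrightarrow> card M = 4" by blast
  finally show ?thesis
    unfolding pseudorectangle_def metric_rectangle_def 1 2 by blast
qed

end

section \<open>The metric reflection as an instance\<close>

context pseudometric_space
begin

lemma metric_projection_reflection:
  "metric_projection X d (reflection X d) (reflection_dist d) (\<lambda>x. zero_rel X d `` {x})"
proof -
  have refl: "zero_rel X d `` {x} \<in> reflection X d" "x \<in> zero_rel X d `` {x}" if "x \<in> X" for x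
    using that equiv_class_self[OF equiv_zero_rel] by (auto simp: reflection_def quotientI)
  interpret M: metric_space_on "reflection X d" "reflection_dist d"
    by (rule metric_space_reflection)
  show ?thesis
  proof
    show "(\<lambda>x. zero_rel X d `` {x}) ` X = reflection X d"
      by (auto simp: reflection_def quotient_def)
    show "reflection_dist d (zero_rel X d `` {x}) (zero_rel X d `` {y}) = d x y"
      if "x \<in> X" "y \<in> X" for x y
      using refl that by (intro reflection_dist_eq) auto
  qed
qed

end

theorem theorem4p4:
  fixes X :: "'a set" and d :: "'a \<Rightarrow> 'a \<Rightarrow> real"
  assumes "pseudometric_space X d" and "X \<noteq> {}"
  shows "(strongly_rigid X d \<or> discrete_pseudometric X d \<or> pseudorectangle X d) \<longleftrightarrow>
    Cs (reflection X d) (reflection_dist d) = BijGroup (reflection X d)"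
proof -
  interpret metric_projection X d "reflection X d" "reflection_dist d" "\<lambda>x. zero_rel X d `` {x}"
    using assms(1) by (rule pseudometric_space.metric_projection_reflection)
  show ?thesis
    by (simp only: strongly_rigid_iff discrete_pseudometric_iff pseudorectangle_iff
        M.Cs_eq_BijGroup_iff_metric)
qed

end
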